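(* Let $\lambda$ be a partition of the integer $n$ with $l(\lambda)=r$, let $d(\lambda)=\binom{n-1}{2}+r-1$ and $$v(\lambda)=d(\lambda)-n+2=\binom{n-2}{2}+r-1.$$ For $\lambda\ne1^n$ (equivalently $1\le r\le n-1$), the part of $M_\lambda$ of degree $\ge v(\lambda)$ (i.e. the sum of all monomials of $M_\lambda$ of degree at least $v(\lambda)$) is given by the following polynomial, which only depends on $n$ and $r$: $$P_n^{(r)}(q)=\frac{(r-1)!}{(n-1)!}\sum_{i=0}^{n-2}\binom{n-r-1+i}{n-r-1}q^{d(\lambda)-i}=\frac{(r-1)!}{(n-1)!}\sum_{j=0}^{n-2}\binom{2n-r-3-j}{n-2-j}q^{v(\lambda)+j}.$$
   Context: Let $\Lambda$ be the algebra of symmetric functions in $x_1,x_2,\dots$ over $\mathbb{Q}(q)$, with monomial symmetric functions $m_\lambda$ and elementary symmetric functions $e_n$ ($e_0=1$). The specialization considered is the $\mathbb{Q}(q)$-algebra homomorphism $\Lambda\to\mathbb{Q}(q)$ determined by $e_n\mapsto q^{\binom n2}/n!$; symmetric functions are identified with their images. For a partition $\lambda=(\lambda_1\ge\dots\ge\lambda_r>0)$: $|\lambda|=\lambda_1+\dots+\lambda_r$, $l(\lambda)=r$; if $r_i$ is the number of parts equal to $i$, then $m(\lambda)!=r_1!\,r_2!\cdots$; $1^n$ is the partition of $n$ with all parts equal to $1$. $M_\lambda(q)\in\mathbb{Q}[q]$ is the polynomial defined by $m(\lambda)!\,m_\lambda=(1-q)^{|\lambda|-l(\lambda)}M_\lambda(q)$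 under this specialization; its degree is $d(\lambda)$. Let $p_n^{(r)}=\sum_{|\lambda|=n,\,l(\lambda)=r}m_\lambda$ for $n\ge r\ge1$, and define $J_n^{(r)}$ under this specialization by $p_n^{(r)}=(1-q)^{n-r}\frac{q^{\binom r2}}{r!\,(n-r)!}J_n^{(r)}(q)$. It is known that for $n-1\ge r\ge1$, $J_n^{(r)}(q)=\sum_{j=1}^{n-r}[r]_q^j\,q^{\binom j2}\binom{n-r}{j}J_{n-r}^{(j)}(q)$, where $[r]_q=1+q+\dots+q^{r-1}$. *)

theory Defs
  imports
    "HOL-Library.Multiset"
    "HOL-Computational_Algebra.Computational_Algebra"
begin

section \<open>The algebra of symmetric functions\<close>

text \<open>
  A monomial in the variables \<open>x\<^sub>0, x\<^sub>1, \<dots>\<close> is encoded as the finite multiset of the indices of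
  its variables, e.g. \<open>x\<^sub>0\<^sup>2 x\<^sub>3\<close> as \<open>{#0, 0, 3#}\<close>, so that the product of monomials is the union of
  multisets, the degree is \<open>size\<close>, and renaming of variables is \<open>image_mset\<close>.  A symmetric
  function is a formal power series (a coefficient for every monomial) of bounded degree that is
  invariant under renaming of the variables.
\<close>

definition symmetric_series :: "(nat multiset \<Rightarrow> 'a) \<Rightarrow> bool" where
  "symmetric_series f \<longleftrightarrow> (\<forall>\<pi> M. bij \<pi> \<longrightarrow> f (image_mset \<pi> M) = f M)"

definition bounded_degree :: "(nat multiset \<Rightarrow> 'a::zero) \<Rightarrow> bool" where
  "bounded_degree f \<longleftrightarrow> (\<exists>d. \<forall>M. f M \<noteq> 0 \<longrightarrow> size M \<le> d)"

typedef (overloaded) 'a symfun =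
    "{f :: nat multiset \<Rightarrow> 'a::zero. symmetric_series f \<and> bounded_degree f}"
  morphisms sym_coeff Abs_symfun
  by (intro exI[of _ "\<lambda>_. 0"]) (simp add: symmetric_series_def bounded_degree_def)

setup_lifting type_definition_symfun

definition factorizations :: "'b multiset \<Rightarrow> ('b multiset \<times> 'b multiset) set" where
  "factorizations M = {(A, B). A + B = M}"

definition series_mult ::
    "('b multiset \<Rightarrow> 'a::comm_ring_1) \<Rightarrow> ('b multiset \<Rightarrow> 'a) \<Rightarrow> 'b multiset \<Rightarrow> 'a" where
  "series_mult f g M = (\<Sum>(A, B)\<in>factorizations M. f A * g B)"

lemma finite_factorizations [simp, intro]: "finite (factorizations M)"
proof -
  have fin: "finite {A. A \<subseteq># M}"
  proof (induction M)
    case empty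
    then show ?case by simp
  next
    case (add x M)
    have "{A. A \<subseteq># add_mset x M} \<subseteq> {A. A \<subseteq># M} \<union> add_mset x ` {A. A \<subseteq># M}"
    proof
      fix A assume "A \<in> {A. A \<subseteq># add_mset x M}"
      then have A: "A \<subseteq># add_mset x M" by simp
      show "A \<in> {A. A \<subseteq># M} \<union> add_mset x ` {A. A \<subseteq># M}"
      proof (cases "x \<in># A")
        case True
        then obtain B where "A = add_mset x B" by (metis multi_member_split)
        with A show ?thesis by auto
      next
        case False
        have "A \<subseteq># M"
        proof (rule mset_subset_eqI)
          fix a
          show "count A a \<le> count M a"
            using mset_subset_eq_count[OF A, of a] False
            by (cases "a = x") (auto simp: not_in_iff)
        qed
        then show ?thesis by simp
      qed
    qed
    then show ?case using add by (meson finite_UnI finite_imageI finite_subset)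
  qed
  have "factorizations M \<subseteq> {A. A \<subseteq># M} \<times> {A. A \<subseteq># M}"
    by (auto simp: factorizations_def)
  then show ?thesis using fin by (meson finite_SigmaI finite_subset)
qed

lemma series_mult_commute: "series_mult f g = series_mult g f"
proof
  fix M
  show "series_mult f g M = series_mult g f M"
    unfolding series_mult_def
    by (rule sum.reindex_bij_witness[of _ prod.swap prod.swap])
      (auto simp: factorizations_def add.commute mult.commute)
qed

lemma series_mult_assoc:
  "series_mult (series_mult f g) h = series_mult f (series_mult g h)"
proof
  fix M
  have "series_mult (series_mult f g) h M =
      (\<Sum>(D, C)\<in>factorizations M. \<Sum>(A, B)\<in>factorizations D. f A * g B * h C)"
    by (auto simp: series_mult_def sum_distrib_right case_prod_unfold intro!: sum.cong)
  also have "\<dots> = (\<Sum>(p, s)\<in>(SIGMA p:factorizations M. factorizations (fst p)).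
      f (fst s) * g (snd s) * h (snd p))"
    by (subst sum.Sigma[symmetric]) (auto simp: case_prod_unfold)
  also have "\<dots> = (\<Sum>(p, s)\<in>(SIGMA p:factorizations M. factorizations (snd p)).
      f (fst p) * (g (fst s) * h (snd s)))"
    by (rule sum.reindex_bij_witness[of _
          "\<lambda>(p, s). ((fst p + fst s, snd s), (fst p, fst s))"
          "\<lambda>(p, s). ((fst s, snd s + snd p), (snd s, snd p))"])
      (auto simp: factorizations_def add.assoc mult.assoc)
  also have "\<dots> = (\<Sum>(A, D)\<in>factorizations M. \<Sum>(B, C)\<in>factorizations D. f A * (g B * h C))"
    by (subst sum.Sigma[symmetric]) (auto simp: case_prod_unfold)
  also have "\<dots> = series_mult f (series_mult g h) M"
    by (auto simp: series_mult_def sum_distrib_left case_prod_unfold intro!: sum.cong)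
  finally show "series_mult (series_mult f g) h M = series_mult f (series_mult g h) M" .
qed

lemma series_mult_one:
  fixes f :: "'b multiset \<Rightarrow> 'a::comm_ring_1"
  shows "series_mult (\<lambda>M. if M = {#} then 1 else 0) f = f"
proof
  fix M :: "'b multiset"
  have "series_mult (\<lambda>M. if M = {#} then 1 else 0) f M =
      (\<Sum>p\<in>{({#} :: 'b multiset, M)}. (if fst p = {#} then 1 else 0) * f (snd p))"
    unfolding series_mult_def case_prod_unfold
    by (rule sum.mono_neutral_right[OF finite_factorizations]) (auto simp: factorizations_def)
  then show "series_mult (\<lambda>M. if M = {#} then 1 else 0) f M = f M" by simp
qed

lemma series_mult_add_left:
  "series_mult (\<lambda>M. f M + g M) h = (\<lambda>M. series_mult f h M + series_mult g h M)"
  by (auto simp: series_mult_def distrib_right case_prod_unfold sum.distrib)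

lemma symmetric_series_mult:
  assumes "symmetric_series f" "symmetric_series g"
  shows "symmetric_series (series_mult f g)"
  unfolding symmetric_series_def
proof (intro allI impI)
  fix \<pi> :: "nat \<Rightarrow> nat" and M
  assume \<pi>: "bij \<pi>"
  have inv1: "image_mset (inv \<pi>) (image_mset \<pi> A) = A" for A
    using \<pi> by (simp add: multiset.map_comp bij_is_inj)
  have inv2: "image_mset \<pi> (image_mset (inv \<pi>) A) = A" for A
    using \<pi> by (simp add: multiset.map_comp o_def bij_is_surj surj_f_inv_f)
  have sym: "f (image_mset \<pi> A) = f A" "g (image_mset \<pi> A) = g A" for A
    using assms \<pi> by (auto simp: symmetric_series_def)
  show "series_mult f g (image_mset \<pi> M) = series_mult f g M"
    unfolding series_mult_def
    by (rule sum.reindex_bij_witness[of _ "map_prod (image_mset \<pi>) (image_mset \<pi>)"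
          "map_prod (image_mset (inv \<pi>)) (image_mset (inv \<pi>))"])
      (auto simp: factorizations_def inv1 inv2 sym simp flip: image_mset_union,
        metis inv2 sym)
qed

lemma bounded_degree_mult:
  assumes "bounded_degree f" "bounded_degree g"
  shows "bounded_degree (series_mult f g)"
proof -
  obtain d e where d: "\<And>M. f M \<noteq> 0 \<Longrightarrow> size M \<le> d" and e: "\<And>M. g M \<noteq> 0 \<Longrightarrow> size M \<le> e"
    using assms unfolding bounded_degree_def by blast
  have "size M \<le> d + e" if "series_mult f g M \<noteq> 0" for M
  proof -
    from that obtain A B where "A + B = M" "f A * g B \<noteq> 0"
      unfolding series_mult_def by (auto simp: factorizations_def elim!: sum.not_neutral_contains_not_neutral)
    then have "f A \<noteq> 0" "g B \<noteq> 0" "size M = size A + size B" by auto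
    with d e show ?thesis by (simp add: add_mono)
  qed
  then show ?thesis unfolding bounded_degree_def by blast
qed

lemma bounded_degree_add:
  fixes f g :: "nat multiset \<Rightarrow> 'a::comm_ring_1"
  assumes "bounded_degree f" "bounded_degree g"
  shows "bounded_degree (\<lambda>M. f M + g M)"
proof -
  obtain d e where d: "\<And>M. f M \<noteq> 0 \<Longrightarrow> size M \<le> d" and e: "\<And>M. g M \<noteq> 0 \<Longrightarrow> size M \<le> e"
    using assms unfolding bounded_degree_def by blast
  have "size M \<le> max d e" if "f M + g M \<noteq> 0" for M
    using that d[of M] e[of M] by (cases "f M = 0") (auto simp: le_max_iff_disj)
  then show ?thesis unfolding bounded_degree_def by blast
qed

lemma bounded_degree_uminus:
  "bounded_degree f \<Longrightarrow> bounded_degree (\<lambda>M. - f M :: 'a::comm_ring_1)"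
  by (auto simp: bounded_degree_def)

instantiation symfun :: (comm_ring_1) comm_ring_1
begin

lift_definition zero_symfun :: "'a symfun" is "\<lambda>_. 0"
  by (auto simp: symmetric_series_def bounded_degree_def)

lift_definition one_symfun :: "'a symfun" is "\<lambda>M. if M = {#} then 1 else 0"
  by (auto simp: symmetric_series_def bounded_degree_def)

lift_definition plus_symfun :: "'a symfun \<Rightarrow> 'a symfun \<Rightarrow> 'a symfun" is "\<lambda>f g M. f M + g M"
  by (auto simp: symmetric_series_def intro: bounded_degree_add)

lift_definition uminus_symfun :: "'a symfun \<Rightarrow> 'a symfun" is "\<lambda>f M. - f M"
  by (auto simp: symmetric_series_def intro: bounded_degree_uminus)

lift_definition minus_symfun :: "'a symfun \<Rightarrow> 'a symfun \<Rightarrow> 'a symfun" is "\<lambda>f g M. f M - g M"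
  using bounded_degree_add[OF _ bounded_degree_uminus]
  by (fastforce simp: symmetric_series_def)

lift_definition times_symfun :: "'a symfun \<Rightarrow> 'a symfun \<Rightarrow> 'a symfun" is series_mult
  by (simp add: symmetric_series_mult bounded_degree_mult)

instance
proof
  fix a b c :: "'a symfun"
  show "a * b * c = a * (b * c)" by transfer (rule series_mult_assoc)
  show "a * b = b * a" by transfer (rule series_mult_commute)
  show "1 * a = a" by transfer (rule series_mult_one)
  show "(a + b) * c = a * c + b * c" by transfer (rule series_mult_add_left)
  show "(0 :: 'a symfun) \<noteq> 1" by transfer (metis zero_neq_one)
qed (transfer; simp add: algebra_simps)+

end

lift_definition sym_scale :: "'a::comm_ring_1 \<Rightarrow> 'a symfun \<Rightarrow> 'a symfun" is "\<lambda>c f M. c * f M"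
  unfolding symmetric_series_def bounded_degree_def by (metis mult_zero_right)

text \<open>The multiset of the nonzero exponents of a monomial.\<close>

definition exponents :: "nat multiset \<Rightarrow> nat multiset" where
  "exponents M = image_mset (count M) (mset_set (set_mset M))"

lemma exponents_image:
  assumes "bij \<pi>"
  shows "exponents (image_mset \<pi> M) = exponents M"
proof -
  have inj: "inj \<pi>" using assms by (rule bij_is_inj)
  have count: "count (image_mset \<pi> M) (\<pi> x) = count M x" for x
  proof -
    have "\<pi> -` {\<pi> x} = {x}" using inj by (auto dest: injD)
    then show ?thesis by (cases "x \<in># M") (auto simp: count_image_mset count_eq_zero_iff)
  qed
  have "exponents (image_mset \<pi> M) =
      image_mset (count (image_mset \<pi> M)) (image_mset \<pi> (mset_set (set_mset M)))"
    unfolding exponents_def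
    by (simp add: image_mset_mset_set inj_on_subset[OF inj])
  also have "\<dots> = exponents M"
    by (simp add: multiset.map_comp exponents_def count o_def)
  finally show ?thesis .
qed

lemma sum_mset_exponents: "sum_mset (exponents M) = size M"
  by (simp add: exponents_def size_multiset_overloaded_eq sum_unfold_sum_mset)

lift_definition monomial_sym :: "nat multiset \<Rightarrow> 'a::comm_ring_1 symfun" is
  "\<lambda>lam M. if exponents M = lam then 1 else 0"
  by (auto simp: symmetric_series_def bounded_degree_def exponents_image
      simp flip: sum_mset_exponents)

lift_definition elementary_sym :: "nat \<Rightarrow> 'a::comm_ring_1 symfun" is
  "\<lambda>n M. if size M = n \<and> (\<forall>i. count M i \<le> 1) then 1 else 0"
proof -
  fix n :: nat
  have mult: "(\<forall>i. count M i \<le> 1) \<longleftrightarrow> (\<forall>k\<in>#exponents M. k \<le> 1)" for M :: "nat multiset"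
    unfolding exponents_def by (auto simp: count_eq_zero_iff) (metis count_eq_zero_iff le0)
  show "symmetric_series (\<lambda>M. if size M = n \<and> (\<forall>i. count M i \<le> 1) then 1 else 0 :: 'a) \<and>
      bounded_degree (\<lambda>M. if size M = n \<and> (\<forall>i. count M i \<le> 1) then 1 else 0 :: 'a)"
    unfolding mult by (auto simp: symmetric_series_def bounded_degree_def exponents_image)
qed

lemma elementary_sym_0: "elementary_sym 0 = 1"
  by transfer auto


section \<open>Partitions\<close>

text \<open>
  A partition \<open>\<lambda>\<close> (named \<open>lam\<close>) is the multiset of its (positive) parts: \<open>|\<lambda>|\<close> is
  \<open>sum_mset lam\<close>, \<open>l(\<lambda>)\<close> is \<open>size lam\<close>, and \<open>1\<^sup>n\<close> is \<open>replicate_mset n 1\<close>.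
\<close>

definition is_partition_of :: "nat multiset \<Rightarrow> nat \<Rightarrow> bool" where
  "is_partition_of lam n \<longleftrightarrow> 0 \<notin># lam \<and> sum_mset lam = n"

definition multiplicity_fact :: "nat multiset \<Rightarrow> nat" where
  "multiplicity_fact lam = (\<Prod>i\<in>set_mset lam. fact (count lam i))"


section \<open>The specialization\<close>

abbreviation fract_of_poly :: "rat poly \<Rightarrow> rat poly fract" where
  "fract_of_poly p \<equiv> Fract p 1"

abbreviation q :: "rat poly fract" where
  "q \<equiv> fract_of_poly [:0, 1:]"

definition algebra_hom :: "('a::comm_ring_1 symfun \<Rightarrow> 'a) \<Rightarrow> bool" where
  "algebra_hom \<phi> \<longleftrightarrow>
     \<phi> 1 = 1 \<and>
     (\<forall>f g. \<phi> (f + g) = \<phi> f + \<phi> g) \<and>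
     (\<forall>f g. \<phi> (f * g) = \<phi> f * \<phi> g) \<and>
     (\<forall>c f. \<phi> (sym_scale c f) = c * \<phi> f)"

definition is_specialization :: "(rat poly fract symfun \<Rightarrow> rat poly fract) \<Rightarrow> bool" where
  "is_specialization \<phi> \<longleftrightarrow>
     algebra_hom \<phi> \<and> (\<forall>n. \<phi> (elementary_sym n) = q ^ (n choose 2) / of_nat (fact n))"

definition M_poly :: "(rat poly fract symfun \<Rightarrow> rat poly fract) \<Rightarrow> nat multiset \<Rightarrow> rat poly" where
  "M_poly \<phi> lam = (THE M. of_nat (multiplicity_fact lam) * \<phi> (monomial_sym lam) =
     (1 - q) ^ (sum_mset lam - size lam) * fract_of_poly M)"

lemma M_poly_eqI:
  assumes "of_nat (multiplicity_fact lam) * \<phi> (monomial_sym lam) =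
    (1 - q) ^ (sum_mset lam - size lam) * fract_of_poly M"
  shows "M_poly \<phi> lam = M"
  unfolding M_poly_def
proof (rule the_equality, rule assms)
  fix N
  assume "of_nat (multiplicity_fact lam) * \<phi> (monomial_sym lam) =
    (1 - q) ^ (sum_mset lam - size lam) * fract_of_poly N"
  moreover have "1 - q \<noteq> 0"
    by (simp add: One_fract_def Zero_fract_def eq_fract one_pCons)
  ultimately have "fract_of_poly N = fract_of_poly M" using assms by simp
  then show "N = M" by (simp add: eq_fract)
qed

text \<open>The sum of all monomials of \<open>p\<close> of degree at least \<open>v\<close>.\<close>

definition upper_part :: "nat \<Rightarrow> 'a::comm_monoid_add poly \<Rightarrow> 'a poly" where
  "upper_part v p = (\<Sum>i\<in>{v..degree p}. monom (coeff p i) i)"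

text \<open>
  \<open>d(\<lambda>)\<close> and \<open>v(\<lambda>)\<close> as functions of \<open>n = |\<lambda>|\<close> and \<open>r = l(\<lambda>)\<close>.  The term \<open>- n + 2\<close> is written
  \<open>+ 2 - n\<close> since subtraction on natural numbers truncates; no truncation occurs for
  \<open>1 \<le> r \<le> n - 1\<close>.
\<close>

definition deg_d :: "nat \<Rightarrow> nat \<Rightarrow> nat" where
  "deg_d n r = ((n - 1) choose 2) + r - 1"

definition deg_v :: "nat \<Rightarrow> nat \<Rightarrow> nat" where
  "deg_v n r = deg_d n r + 2 - n"

definition P_poly :: "nat \<Rightarrow> nat \<Rightarrow> rat poly" where
  "P_poly n r = smult (fact (r - 1) / fact (n - 1))
     (\<Sum>i=0..n-2. monom (of_nat ((n - r - 1 + i) choose (n - r - 1))) (deg_d n r - i))"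

end

(*
Modulo products of symmetric functions of positive degree, m(lam)! m_lam is congruent to
(-1)^(n-r) n (r-1)! e_n.  The specialization sends e_n to q^(n choose 2) / n!, but every product
of total degree n to a polynomial of degree at most (n-1) choose 2 = (n choose 2) - (n-1).
Dividing by (1-q)^(n-r), expanded at q = infinity, therefore determines the n-1 top coefficients
of M_lam from n and r alone: they are binomial coefficients.  Divisibility by (1-q)^(n-r) reduces,
via p_k m_mu = (sum of augmented monomials), to the power sums, where it follows from the
functional equation E'(t) = E(qt) of the generating function of the e_n.
*)

theory Submission
  imports Defs
begin

section \<open>Multiplication by power sums\<close>

text \<open>The augmented monomial symmetric functions. With this normalization the product with a
  power sum has coefficient 1 for the new part and for each existing part, and \<open>M_poly\<close>
  is defined from exactly this multiple.\<close>

definition augmented_sym :: "nat multiset \<Rightarrow> 'a::comm_ring_1 symfun" where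
  "augmented_sym lam = of_nat (multiplicity_fact lam) * monomial_sym lam"

lemma multiplicity_fact_add_mset:
  "multiplicity_fact (add_mset a lam) = multiplicity_fact lam * Suc (count lam a)"
proof -
  have "(\<Prod>i\<in>set_mset lam - {a}. fact (count (add_mset a lam) i)) =
      (\<Prod>i\<in>set_mset lam - {a}. fact (count lam i) :: nat)"
    by (rule prod.cong) auto
  moreover have "multiplicity_fact (add_mset a lam) =
      fact (Suc (count lam a)) * (\<Prod>i\<in>set_mset lam - {a}. fact (count (add_mset a lam) i))"
    unfolding multiplicity_fact_def set_mset_add_mset_insert
    by (subst prod.insert_remove) auto
  moreover have "multiplicity_fact lam =
      fact (count lam a) * (\<Prod>i\<in>set_mset lam - {a}. fact (count lam i))"
  proof (cases "a \<in># lam")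
    case True
    then show ?thesis unfolding multiplicity_fact_def by (subst prod.remove) auto
  next
    case False
    then have "set_mset lam - {a} = set_mset lam" "count lam a = 0"
      by (auto simp: not_in_iff)
    then show ?thesis unfolding multiplicity_fact_def by simp
  qed
  ultimately show ?thesis by (simp add: algebra_simps)
qed

lemma multiplicity_fact_replicate: "multiplicity_fact (replicate_mset n a) = fact n"
proof (induction n)
  case 0
  then show ?case by (simp add: multiplicity_fact_def)
next
  case (Suc n)
  then show ?case by (simp add: multiplicity_fact_add_mset)
qed

lemma multiplicity_fact_single: "multiplicity_fact {#a#} = 1"
  using multiplicity_fact_replicate[of 1 a] by simp

section \<open>Exponents of monomials and division by a power of one variable\<close>

lemma exponents_split:
  "exponents M = (if x \<in># M then {#count M x#} else {#}) + exponents (filter_mset (\<lambda>y. y \<noteq> x) M)"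
proof -
  have "set_mset (filter_mset (\<lambda>y. y \<noteq> x) M) = set_mset M - {x}" by auto
  then have rest: "exponents (filter_mset (\<lambda>y. y \<noteq> x) M) =
      image_mset (count M) (mset_set (set_mset M - {x}))"
    unfolding exponents_def by (simp only:) (rule image_mset_cong, simp)
  show ?thesis
  proof (cases "x \<in># M")
    case True
    then have "mset_set (set_mset M) = add_mset x (mset_set (set_mset M - {x}))"
      by (simp add: mset_set.remove)
    then show ?thesis using True unfolding rest by (simp add: exponents_def)
  next
    case False
    then show ?thesis unfolding rest by (simp add: exponents_def)
  qed
qed

lemma exponents_replicate: "k > 0 \<Longrightarrow> exponents (replicate_mset k x) = {#k#}"
  by (simp add: exponents_def)

text \<open>So the monomials of the power sum \<open>monomial_sym {#k#}\<close> are the pure powers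
  of one variable.\<close>

lemma exponents_eq_single_iff:
  assumes "k > 0"
  shows "exponents M = {#k#} \<longleftrightarrow> (\<exists>x. M = replicate_mset k x)"
proof
  assume E: "exponents M = {#k#}"
  then have "size (mset_set (set_mset M)) = 1"
    by (metis exponents_def size_image_mset size_single)
  then obtain x where x: "set_mset M = {x}" by (auto simp: card_1_singleton_iff)
  with E have "count M x = k" by (simp add: exponents_def)
  moreover have "count M y = 0" if "y \<noteq> x" for y
    using x that by (metis count_eq_zero_iff singletonD)
  ultimately have "M = replicate_mset k x" by (intro multiset_eqI) auto
  then show "\<exists>x. M = replicate_mset k x" ..
qed (use assms exponents_replicate in auto)

text \<open>Dividing by \<open>x^k\<close> turns the exponent c of x into c - k, which disappears if
  c = k. The old exponent is added on the left to avoid a difference of multisets.\<close>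

lemma exponents_diff_replicate:
  assumes "k > 0" "k \<le> count M x"
  shows "add_mset (count M x) (exponents (M - replicate_mset k x)) =
    exponents M + (if k < count M x then {#count M x - k#} else {#})"
proof -
  have "filter_mset (\<lambda>y. y \<noteq> x) (M - replicate_mset k x) = filter_mset (\<lambda>y. y \<noteq> x) M"
    by (rule multiset_eqI) auto
  moreover have "x \<in># M" using assms by (simp flip: count_greater_zero_iff)
  moreover have "x \<in># M - replicate_mset k x \<longleftrightarrow> k < count M x"
    by (simp add: in_diff_count)
  ultimately show ?thesis
    using exponents_split[of M x] exponents_split[of "M - replicate_mset k x" x] by simp
qed

text \<open>Turns a count of variables into a count of parts; the assumption on 0 confines the set
  to the finitely many variables that occur in M.\<close>

lemma card_count_exponents:
  assumes "\<not> P 0"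
  shows "card {x. P (count M x)} = size (filter_mset P (exponents M))"
proof -
  have "x \<in># M" if "P (count M x)" for x
    using assms that by (metis count_inI)
  then have "{x. P (count M x)} = {x \<in> set_mset M. P (count M x)}"
    by blast
  then show ?thesis
    by (simp add: exponents_def filter_mset_image_mset)
qed

lemma sym_coeff_of_nat_mult: "sym_coeff (of_nat k * f) M = of_nat k * sym_coeff f M"
  by (induction k) (simp_all add: distrib_right plus_symfun.rep_eq zero_symfun.rep_eq)

lemma sym_coeff_sum_mset: "sym_coeff (\<Sum>x\<in>#A. f x) M = (\<Sum>x\<in>#A. sym_coeff (f x) M)"
  by (induction A) (simp_all add: plus_symfun.rep_eq zero_symfun.rep_eq)

text \<open>The coefficient counts the variables x for which \<open>x^k\<close> divides M with a
  quotient of type \<open>mu\<close>. By \<open>exponents_diff_replicate\<close> this depends only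
  on the exponent c of x.\<close>

lemma sym_coeff_powersum_mult:
  assumes "k > 0"
  shows "sym_coeff (monomial_sym {#k#} * monomial_sym mu :: 'a::comm_ring_1 symfun) M =
    of_nat (size {#c \<in># exponents M. k \<le> c \<and>
      add_mset c mu = exponents M + (if k < c then {#c - k#} else {#})#})"
proof -
  define X where "X = {x. k \<le> count M x \<and> exponents (M - replicate_mset k x) = mu}"
  let ?f = "\<lambda>x. (replicate_mset k x, M - replicate_mset k x)"
  have inj: "inj_on ?f X"
    using assms by (auto simp: inj_on_def replicate_mset_eq_iff)
  have sub: "replicate_mset k x \<subseteq># M \<longleftrightarrow> k \<le> count M x" for x
    by (simp add: count_le_replicate_mset_subset_eq)
  \<comment> \<open>The variables in X correspond to the factorizations of M that contribute 1 to
    the product.\<close>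
  have eq: "?f ` X = {p \<in> factorizations M. exponents (fst p) = {#k#} \<and> exponents (snd p) = mu}"
    (is "_ = ?R")
  proof
    show "?f ` X \<subseteq> ?R"
      using assms by (auto simp: X_def factorizations_def exponents_replicate
          simp flip: sub)
    show "?R \<subseteq> ?f ` X"
    proof
      fix p assume p: "p \<in> ?R"
      then obtain x where x: "fst p = replicate_mset k x"
        using exponents_eq_single_iff[OF assms] by auto
      with p have M: "replicate_mset k x + snd p = M" by (auto simp: factorizations_def)
      then have "snd p = M - replicate_mset k x" by auto
      moreover from M have "k \<le> count M x" by (auto simp flip: sub)
      ultimately have "p = ?f x" "x \<in> X" using p x by (auto simp: X_def prod_eq_iff)
      then show "p \<in> ?f ` X" by blast
    qed
  qed
  have "sym_coeff (monomial_sym {#k#} * monomial_sym mu :: 'a symfun) M =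
      (\<Sum>p\<in>factorizations M. if exponents (fst p) = {#k#} \<and> exponents (snd p) = mu then 1 else 0)"
    unfolding times_symfun.rep_eq monomial_sym.rep_eq series_mult_def case_prod_unfold
    by (rule sum.cong) auto
  also have "\<dots> = of_nat (card (?f ` X))"
    unfolding eq by (subst sum.inter_filter[symmetric]) auto
  also have "card (?f ` X) = card X"
    by (rule card_image[OF inj])
  also have "X = {x. k \<le> count M x \<and>
      add_mset (count M x) mu = exponents M + (if k < count M x then {#count M x - k#} else {#})}"
    unfolding X_def
  proof (intro Collect_cong conj_cong refl)
    fix x assume "k \<le> count M x"
    then show "exponents (M - replicate_mset k x) = mu \<longleftrightarrow>
        add_mset (count M x) mu = exponents M + (if k < count M x then {#count M x - k#} else {#})"
      unfolding exponents_diff_replicate[OF assms \<open>k \<le> count M x\<close>, symmetric] by auto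
  qed
  also have "card \<dots> = size {#c \<in># exponents M. k \<le> c \<and>
      add_mset c mu = exponents M + (if k < c then {#c - k#} else {#})#}"
    by (rule card_count_exponents) (use assms in simp)
  finally show ?thesis .
qed

text \<open>The counting behind the product rule. Either \<open>nu\<close> is \<open>mu\<close> with
  a new part k, or it arises by enlarging one part a by k, or both sides vanish; the first two cases
  differ in the number of parts. In each of them only one value of c qualifies, and its multiplicity
  in \<open>nu\<close> completes the factorials.\<close>

lemma multiplicity_fact_merge:
  assumes "k > 0" "0 \<notin># mu"
  shows "multiplicity_fact mu * size {#c \<in># nu. k \<le> c \<and>
      add_mset c mu = nu + (if k < c then {#c - k#} else {#})#} =
    (if nu = add_mset k mu then multiplicity_fact nu else 0) +
    (\<Sum>a\<in>#mu. if nu = add_mset (a + k) (mu - {#a#}) then multiplicity_fact nu else 0)"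
    (is "_ * size (filter_mset ?P nu) = _")
proof -
  consider (new) "nu = add_mset k mu"
    | (merge) a rho where "mu = add_mset a rho" "nu = add_mset (a + k) rho"
    | (none) "nu \<noteq> add_mset k mu" "\<And>a. a \<in># mu \<Longrightarrow> nu \<noteq> add_mset (a + k) (mu - {#a#})"
    by (metis insert_DiffM)
  then show ?thesis
  proof cases
    case new
    have P: "?P c \<longleftrightarrow> c = k" for c
      using new by (auto dest: arg_cong[of _ _ size])
    have "nu \<noteq> add_mset (a + k) (mu - {#a#})" if "a \<in># mu" for a
      using new by (metis insert_DiffM n_not_Suc_n size_add_mset that)
    then have "(\<Sum>a\<in>#mu. if nu = add_mset (a + k) (mu - {#a#}) then multiplicity_fact nu else 0) =
        (\<Sum>a\<in>#mu. 0)"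
      by (intro arg_cong[of _ _ sum_mset] image_mset_cong) auto
    moreover have "size (filter_mset (\<lambda>c. c = k) nu) = Suc (count mu k)"
      using new by (simp add: filter_eq_replicate_mset)
    moreover have "multiplicity_fact nu = multiplicity_fact mu * Suc (count mu k)"
      using new by (simp only: multiplicity_fact_add_mset)
    ultimately show ?thesis
      using new unfolding P by (simp del: mult_Suc_right)
  next
    case merge
    have "a > 0" using merge assms by (cases a) auto
    have P: "?P c \<longleftrightarrow> c = a + k" for c
    proof
      assume c: "?P c"
      then have "k < c" using merge by (cases "c = k") (auto dest: arg_cong[of _ _ size])
      with c merge have "add_mset c (add_mset a rho) = add_mset (c - k) (add_mset (a + k) rho)"
        by (simp add: add_mset_commute)
      \<comment> \<open>After cancelling \<open>rho\<close>, c must be one of c - k and a + k; the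
        former is excluded by k > 0.\<close>
      then have "{#c, a#} + rho = {#c - k, a + k#} + rho" by simp
      then have "{#c, a#} = {#c - k, a + k#}" by (simp only: add_right_cancel)
      then show "c = a + k" using \<open>k < c\<close> assms by (auto simp: add_eq_conv_diff)
    qed (use merge \<open>a > 0\<close> in \<open>auto simp: add_mset_commute\<close>)
    have Q: "nu = add_mset (b + k) (mu - {#b#}) \<longleftrightarrow> b = a" if b: "b \<in># mu" for b
    proof
      assume "nu = add_mset (b + k) (mu - {#b#})"
      then have "add_mset b nu = add_mset (b + k) mu" using b
        by (metis add_mset_commute insert_DiffM)
      then have "{#b, a + k#} + rho = {#b + k, a#} + rho" using merge by simp
      then have "{#b, a + k#} = {#b + k, a#}" by (simp only: add_right_cancel)
      then show "b = a" using assms by (auto simp: add_eq_conv_diff)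
    qed (use merge in auto)
    have "(\<Sum>b\<in>#mu. if nu = add_mset (b + k) (mu - {#b#}) then multiplicity_fact nu else 0) =
        (\<Sum>b\<in>#mu. if b = a then multiplicity_fact nu else 0)"
      using Q by (intro arg_cong[of _ _ sum_mset] image_mset_cong) auto
    also have "\<dots> = count mu a * multiplicity_fact nu"
      by (induction mu) auto
    finally have sum: "(\<Sum>b\<in>#mu. if nu = add_mset (b + k) (mu - {#b#}) then multiplicity_fact nu else 0) =
        count mu a * multiplicity_fact nu" .
    have "nu \<noteq> add_mset k mu" using merge by (auto dest: arg_cong[of _ _ size])
    moreover have "multiplicity_fact mu = multiplicity_fact rho * count mu a"
      "multiplicity_fact nu = multiplicity_fact rho * count nu (a + k)"
      using merge by (simp_all only: multiplicity_fact_add_mset) simp_all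
    ultimately show ?thesis
      unfolding P sum by (simp add: filter_eq_replicate_mset)
  next
    case none
    have no: "\<not> ?P c" for c
    proof
      \<comment> \<open>Such a c is either k, a new part, or comes from the part c - k of
        \<open>mu\<close> enlarged by k; both are ruled out.\<close>
      assume c: "?P c"
      then have "k < c" using none(1) by (cases "c = k") auto
      with c have eq: "add_mset c mu = add_mset (c - k) nu" by simp
      have "c - k \<noteq> c" using assms \<open>k < c\<close> by simp
      with eq have mem: "c - k \<in># mu" by (metis insert_noteq_member union_single_eq_member)
      then have "nu = add_mset c (mu - {#c - k#})"
        using eq by (metis add_mset_commute add_mset_add_mset_same_iff insert_DiffM)
      then show False using none(2)[OF mem] \<open>k < c\<close> by simp
    qed
    have sum: "(\<Sum>a\<in>#mu. if nu = add_mset (a + k) (mu - {#a#}) then multiplicity_fact nu else 0) =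
        (\<Sum>a\<in>#mu. 0)"
      using none(2) by (intro arg_cong[of _ _ sum_mset] image_mset_cong) auto
    have "filter_mset ?P nu = filter_mset (\<lambda>_. False) nu"
      by (rule filter_mset_cong) (use no in blast)+
    then have "filter_mset ?P nu = {#}" by (simp only: filter_mset_False)
    then have "size (filter_mset ?P nu) = 0" by (simp only: size_empty)
    then show ?thesis using none(1) unfolding sum by simp
  qed
qed

text \<open>A factor \<open>x^k\<close> either meets a monomial without x, giving a new part k, or
  raises an exponent a to a + k. Comparing coefficients at M leads to
  \<open>multiplicity_fact_merge\<close> with \<open>nu = exponents M\<close>.\<close>

lemma powersum_mult_augmented:
  assumes "k > 0" "0 \<notin># mu"
  shows "monomial_sym {#k#} * augmented_sym mu =
    augmented_sym (add_mset k mu) + (\<Sum>a\<in>#mu. augmented_sym (add_mset (a + k) (mu - {#a#})))"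
    (is "?L = ?R")
proof -
  have "sym_coeff ?L M = sym_coeff ?R M" for M
  proof -
    have "sym_coeff ?L M = of_nat (multiplicity_fact mu) *
        sym_coeff (monomial_sym {#k#} * monomial_sym mu :: 'a symfun) M"
      unfolding augmented_sym_def by (simp add: mult.left_commute sym_coeff_of_nat_mult)
    also have "\<dots> = of_nat ((if exponents M = add_mset k mu then multiplicity_fact (exponents M) else 0) +
        (\<Sum>a\<in>#mu. if exponents M = add_mset (a + k) (mu - {#a#})
          then multiplicity_fact (exponents M) else 0))"
      unfolding sym_coeff_powersum_mult[OF assms(1)] of_nat_mult[symmetric]
        multiplicity_fact_merge[OF assms] ..
    also have "\<dots> = sym_coeff ?R M"
      unfolding augmented_sym_def plus_symfun.rep_eq sym_coeff_sum_mset sym_coeff_of_nat_mult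
        monomial_sym.rep_eq
      by (auto simp: of_nat_sum_mset multiset.map_comp o_def intro!: arg_cong[of _ _ sum_mset] image_mset_cong)
    finally show ?thesis .
  qed
  then show ?thesis by (intro sym_coeff_inject[THEN iffD1] ext)
qed

lemma monomial_sym_ones: "monomial_sym (replicate_mset n 1) = elementary_sym n"
proof -
  have "exponents M = replicate_mset n 1 \<longleftrightarrow> size M = n \<and> (\<forall>i. count M i \<le> 1)" for M
  proof
    assume E: "exponents M = replicate_mset n 1"
    then have "size M = n" by (metis sum_mset_exponents sum_mset_replicate_mset mult.right_neutral of_nat_id)
    moreover have "count M i \<le> 1" for i
    proof (cases "i \<in># M")
      case True
      then have "count M i \<in># exponents M" by (simp add: exponents_def)
      then show ?thesis using E by (auto split: if_splits)
    qed (simp add: not_in_iff)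
    ultimately show "size M = n \<and> (\<forall>i. count M i \<le> 1)" by blast
  next
    assume M: "size M = n \<and> (\<forall>i. count M i \<le> 1)"
    then have one: "count M i = 1" if "i \<in># M" for i
      using that by (simp add: le_antisym Suc_leI)
    then have "exponents M = image_mset (\<lambda>_. 1) (mset_set (set_mset M))"
      unfolding exponents_def by (intro image_mset_cong) auto
    moreover have "card (set_mset M) = n"
      using M one by (auto simp: size_multiset_overloaded_eq)
    ultimately show "exponents M = replicate_mset n 1"
      by (simp add: image_mset_const_eq)
  qed
  then show ?thesis by transfer auto
qed

section \<open>Truncated negative binomial series\<close>

lemma choose_two_Suc: "Suc n choose 2 = (n choose 2) + n"
  by (simp add: numeral_2_eq_2)

lemma choose_two_add: "(k + l) choose 2 = (k choose 2) + (l choose 2) + k * l"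
  by (induction k) (simp_all add: choose_two_Suc)

text \<open>For k = a + 1 and l = b + 1 the difference of the two sides is ab. This bound keeps
  products of elements of positive degrees out of the leading term.\<close>

lemma choose_two_add_le:
  assumes "k > 0" "l > 0"
  shows "(k choose 2) + (l choose 2) \<le> (k + l - 1) choose 2"
proof -
  obtain a b where "k = Suc a" "l = Suc b" using assms by (meson gr0_implies_Suc)
  then show ?thesis by (simp add: choose_two_Suc choose_two_add)
qed

text \<open>This is the polynomial part of \<open>X^(N+t+1) / (X-1)^(t+1)\<close>, see \<open>degree_binomial_poly_mult\<close>.\<close>

definition binomial_poly :: "nat \<Rightarrow> nat \<Rightarrow> rat poly" where
  "binomial_poly t N = (\<Sum>i=0..N. monom (of_nat ((t + i) choose t)) (N - i))"

lemma binomial_poly_Suc: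
  "binomial_poly t (Suc N) = monom 1 1 * binomial_poly t N + monom (of_nat ((t + Suc N) choose t)) 0"
proof -
  have "(\<Sum>i=0..N. monom (of_nat ((t + i) choose t)) (Suc N - i)) =
      monom 1 1 * (binomial_poly t N :: rat poly)"
    unfolding binomial_poly_def sum_distrib_left
    by (rule sum.cong) (auto simp: mult_monom Suc_diff_le)
  then show ?thesis by (simp add: binomial_poly_def)
qed

text \<open>A factor X - 1 lowers the order of the pole by one; coefficientwise this is Pascal's
  rule, and the subtracted constant is the truncation error.\<close>

lemma binomial_poly_step:
  "(monom 1 1 - 1) * binomial_poly (Suc t) N =
    monom 1 1 * binomial_poly t N - monom (of_nat ((Suc t + N) choose Suc t)) 0"
proof (induction N)
  case 0
  then show ?case by (simp add: binomial_poly_def monom_0 one_pCons)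
next
  case (Suc N)
  let ?X = "monom 1 1 :: rat poly" and ?C = "\<lambda>a b. monom (of_nat (a choose b)) 0 :: rat poly"
  have "(?X - 1) * binomial_poly (Suc t) (Suc N) =
      ?X * ((?X - 1) * binomial_poly (Suc t) N) + (?X - 1) * ?C (Suc t + Suc N) (Suc t)"
    unfolding binomial_poly_Suc by (simp add: algebra_simps)
  also have "\<dots> = ?X * (?X * binomial_poly t N) + ?X * (?C (Suc t + Suc N) (Suc t) - ?C (Suc t + N) (Suc t))
      - ?C (Suc t + Suc N) (Suc t)"
    unfolding Suc.IH by (simp add: algebra_simps)
  also have "?C (Suc t + Suc N) (Suc t) - ?C (Suc t + N) (Suc t) = ?C (t + Suc N) t"
    by (simp add: add_monom diff_monom flip: of_nat_diff)
  finally show ?case unfolding binomial_poly_Suc by (simp add: algebra_simps)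
qed

text \<open>The base case is a geometric sum. By \<open>binomial_poly_step\<close> the remainder R
  for t becomes X R - b (X-1)^(t+1) for t + 1, so the degree bound grows by one.\<close>

lemma degree_binomial_poly_mult:
  "degree ((monom 1 1 - 1) ^ Suc t * binomial_poly t N - monom 1 (N + Suc t)) \<le> t"
proof (induction t)
  case 0
  have "(monom 1 1 - 1) * binomial_poly 0 N = monom 1 (Suc N) - 1"
  proof (induction N)
    case 0
    then show ?case by (simp add: binomial_poly_def)
  next
    case (Suc N)
    have "(monom 1 1 - 1) * binomial_poly 0 (Suc N) =
        monom 1 1 * ((monom 1 1 - 1) * binomial_poly 0 N) + (monom 1 1 - 1)"
      unfolding binomial_poly_Suc by (simp add: algebra_simps)
    also have "\<dots> = monom 1 (Suc (Suc N)) - 1"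
      unfolding Suc.IH by (simp add: right_diff_distrib mult_monom)
    finally show ?case .
  qed
  then show ?case by simp
next
  case (Suc t)
  let ?X = "monom 1 1 :: rat poly"
  define R where "R = (?X - 1) ^ Suc t * binomial_poly t N - monom 1 (N + Suc t)"
  define b :: rat where "b = of_nat ((Suc t + N) choose Suc t)"
  have "(?X - 1) ^ Suc (Suc t) * binomial_poly (Suc t) N =
      (?X - 1) ^ Suc t * ((?X - 1) * binomial_poly (Suc t) N)"
    by (simp only: power_Suc ac_simps)
  also have "\<dots> = ?X * ((?X - 1) ^ Suc t * binomial_poly t N) - monom b 0 * (?X - 1) ^ Suc t"
    unfolding binomial_poly_step b_def by (simp only: right_diff_distrib ac_simps)
  also have "(?X - 1) ^ Suc t * binomial_poly t N = R + monom 1 (N + Suc t)"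
    by (simp add: R_def)
  finally have eq: "(?X - 1) ^ Suc (Suc t) * binomial_poly (Suc t) N - monom 1 (N + Suc (Suc t)) =
      ?X * R - monom b 0 * (?X - 1) ^ Suc t"
    by (simp add: distrib_left mult_monom)
  have "degree (?X - 1) \<le> 1" by (simp add: degree_diff_le degree_monom_le)
  then have "degree ((?X - 1) ^ Suc t) \<le> Suc t"
    using degree_power_le[of "?X - 1" "Suc t"] mult_le_mono1[of "degree (?X - 1)" 1 "Suc t"]
    by (metis mult_1 order_trans)
  then have "degree (monom b 0 * (?X - 1) ^ Suc t) \<le> Suc t"
    by (auto simp: monom_0 intro: order_trans[OF degree_smult_le])
  moreover have "degree (?X * R) \<le> Suc t"
    using Suc.IH degree_mult_le[of ?X R] unfolding R_def[symmetric] by (simp add: degree_monom_eq)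
  ultimately show ?case unfolding eq by (rule degree_diff_le[rotated])
qed

text \<open>Two approximate quotients of T by A agree at the top: A (M - P) has degree at most e, so
  M - P has degree below v.\<close>

lemma coeff_eq_above:
  fixes A M P :: "'a::idom poly"
  assumes "A \<noteq> 0" "degree (A * M - T) \<le> e" "degree (A * P - T) \<le> e" "e < v + degree A" "v \<le> i"
  shows "coeff M i = coeff P i"
proof (cases "M = P")
  case False
  have "A * (M - P) = (A * M - T) - (A * P - T)" by (simp add: algebra_simps)
  then have "degree (A * (M - P)) \<le> e" using assms(2,3) by (simp only: degree_diff_le)
  then have "degree A + degree (M - P) \<le> e" using assms(1) False by (simp add: degree_mult_eq)
  then have "degree (M - P) < i" using assms by linarith
  then have "coeff (M - P) i = 0" by (rule coeff_eq_0)
  then show ?thesis by simp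
qed simp

lemma upper_part_eqI:
  assumes "\<And>i. v \<le> i \<Longrightarrow> coeff p i = coeff u i" "\<And>i. i < v \<Longrightarrow> coeff u i = 0"
  shows "upper_part v p = u"
proof (rule poly_eqI)
  fix i
  have "coeff (upper_part v p) i = (if i \<in> {v..degree p} then coeff p i else 0)"
    unfolding upper_part_def by (simp add: coeff_sum coeff_monom if_distrib sum.delta cong: if_cong)
  also have "\<dots> = coeff u i"
    using assms[of i] coeff_eq_0[of p i] by (cases "v \<le> i") auto
  finally show "coeff (upper_part v p) i = coeff u i" .
qed

section \<open>The polynomial \<open>P_poly\<close> and its product with a power of 1 - q\<close>

lemma deg_v_eq:
  assumes "n \<ge> 2" "r \<ge> 1"
  shows "deg_v n r = ((n - 2) choose 2) + r - 1"
    and "deg_d n r = deg_v n r + (n - 2)"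
proof -
  obtain k where n: "n = Suc (Suc k)" using assms by (metis add_2_eq_Suc le_Suc_ex)
  show "deg_v n r = ((n - 2) choose 2) + r - 1" "deg_d n r = deg_v n r + (n - 2)"
    using assms by (simp_all add: n deg_v_def deg_d_def choose_two_Suc)
qed

lemma P_poly_eq:
  assumes "r \<ge> 1" "r < n"
  shows "P_poly n r = smult (fact (r - 1) / fact (n - 1))
    (monom 1 (deg_v n r) * binomial_poly (n - r - 1) (n - 2))"
proof -
  have "deg_d n r = deg_v n r + (n - 2)" using assms by (intro deg_v_eq) auto
  then have "deg_d n r - i = deg_v n r + (n - 2 - i)" if "i \<in> {0..n - 2}" for i
    using that by simp
  then show ?thesis
    unfolding P_poly_def binomial_poly_def sum_distrib_left
    by (intro arg_cong[of _ _ "smult _"] sum.cong refl) (simp only: mult_monom mult_1)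
qed

text \<open>Substitution j = n - 2 - i and the symmetry of binomial coefficients.\<close>

lemma P_poly_rev:
  assumes "r \<ge> 1" "r < n"
  shows "P_poly n r = smult (fact (r - 1) / fact (n - 1))
    (\<Sum>j=0..n-2. monom (of_nat ((2 * n - r - 3 - j) choose (n - 2 - j))) (deg_v n r + j))"
proof -
  have d: "deg_d n r = deg_v n r + (n - 2)" using assms by (intro deg_v_eq) auto
  have "(\<Sum>i=0..n-2. monom (of_nat ((n - r - 1 + i) choose (n - r - 1))) (deg_d n r - i) :: rat poly) =
      (\<Sum>j=0..n-2. monom (of_nat ((2 * n - r - 3 - j) choose (n - 2 - j))) (deg_v n r + j))"
  proof (rule sum.reindex_bij_witness[of _ "\<lambda>j. n - 2 - j" "\<lambda>i. n - 2 - i"])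
    fix i assume i: "i \<in> {0..n - 2}"
    then have "2 * n - r - 3 - (n - 2 - i) = n - r - 1 + i" "n - 2 - (n - 2 - i) = i"
      using assms by auto
    moreover have "(n - r - 1 + i) choose (n - r - 1) = (n - r - 1 + i) choose i"
      using binomial_symmetric[of i "n - r - 1 + i"] by simp
    moreover have "deg_v n r + (n - 2 - i) = deg_d n r - i" using i d by auto
    ultimately show "monom (of_nat ((2 * n - r - 3 - (n - 2 - i)) choose (n - 2 - (n - 2 - i))))
        (deg_v n r + (n - 2 - i)) =
        (monom (of_nat ((n - r - 1 + i) choose (n - r - 1))) (deg_d n r - i) :: rat poly)"
      by simp
  qed auto
  then show ?thesis unfolding P_poly_def by simp
qed

text \<open>With t = n - r - 1, (1-q)^(n-r) is (-1)^(n-r) (q-1)^(t+1), which undoes the truncated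
  expansion up to an error of degree at most v + t = (n-1 choose 2). The remaining monomial is the
  leading term that \<open>admissible_augmented\<close> finds.\<close>

lemma degree_mult_P_poly:
  assumes "r \<ge> 1" "r < n"
  shows "degree ([:1, -1:] ^ (n - r) * P_poly n r -
    monom ((-1) ^ (n - r) * fact (r - 1) / fact (n - 1)) (n choose 2)) \<le> (n - 1) choose 2"
proof -
  obtain t where t: "n - r = Suc t" using assms by (metis Suc_diff_Suc)
  let ?X = "monom 1 1 :: rat poly"
  define c :: rat where "c = fact (r - 1) / fact (n - 1)"
  define R where "R = (?X - 1) ^ Suc t * binomial_poly t (n - 2) - monom 1 (n - 2 + Suc t)"
  have deg: "deg_v n r = ((n - 2) choose 2) + r - 1" using assms by (intro deg_v_eq) auto
  have "n = Suc (Suc (n - 2))" using assms by linarith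
  then obtain k where n: "n = Suc (Suc k)" ..
  have v: "deg_v n r + t = (n - 1) choose 2" "deg_v n r + (n - 2 + Suc t) = n choose 2"
    unfolding deg using assms t by (auto simp: n choose_two_Suc)
  have X: "[:1, -1:] = - (?X - 1)" by (simp add: one_pCons monom_altdef)
  have "[:1, -1:] ^ (n - r) = smult ((-1) ^ Suc t) ((?X - 1) ^ Suc t)"
    unfolding X t by (subst power_minus) (cases "even (Suc t)", simp_all)
  then have "[:1, -1:] ^ (n - r) * P_poly n r = smult ((-1) ^ Suc t * c)
      (monom 1 (deg_v n r) * ((?X - 1) ^ Suc t * binomial_poly t (n - 2)))"
    using P_poly_eq[OF assms] t by (simp add: c_def ac_simps)
  also have "(?X - 1) ^ Suc t * binomial_poly t (n - 2) = R + monom 1 (n - 2 + Suc t)"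
    by (simp add: R_def)
  finally have "[:1, -1:] ^ (n - r) * P_poly n r - monom ((-1) ^ (n - r) * c) (n choose 2) =
      smult ((-1) ^ Suc t * c) (monom 1 (deg_v n r) * R)"
    using v(2) t by (simp add: distrib_left mult_monom smult_add_right smult_monom)
  moreover have "degree (smult ((-1) ^ Suc t * c) (monom 1 (deg_v n r) * R)) \<le> deg_v n r + degree R"
    using degree_mult_le[of "monom 1 (deg_v n r)" R]
    by (simp add: degree_monom_eq order_trans[OF degree_smult_le])
  moreover have "degree R \<le> t"
    unfolding R_def by (rule degree_binomial_poly_mult)
  ultimately show ?thesis using v(1) by (simp add: c_def)
qed

section \<open>Leading terms and divisibility\<close>

lemma size_le_sum_mset: "0 \<notin># lam \<Longrightarrow> size lam \<le> sum_mset (lam :: nat multiset)"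
proof (induction lam)
  case (add a lam)
  then show ?case by (cases a) auto
qed simp

lemma size_eq_sum_mset_iff:
  "0 \<notin># lam \<Longrightarrow> size lam = sum_mset lam \<longleftrightarrow> lam = replicate_mset (sum_mset (lam :: nat multiset)) 1"
proof (induction lam)
  case (add a lam)
  then have "size lam \<le> sum_mset lam" "a > 0" using size_le_sum_mset[of lam] by auto
  then have "size (add_mset a lam) = sum_mset (add_mset a lam) \<longleftrightarrow> a = 1 \<and> size lam = sum_mset lam"
    by auto
  also have "\<dots> \<longleftrightarrow> add_mset a lam = replicate_mset (sum_mset (add_mset a lam)) 1"
  proof
    assume "a = 1 \<and> size lam = sum_mset lam"
    then show "add_mset a lam = replicate_mset (sum_mset (add_mset a lam)) 1"
      using add by simp
  next
    assume eq: "add_mset a lam = replicate_mset (sum_mset (add_mset a lam)) 1"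
    then have "a = 1" by (metis in_replicate_mset union_single_eq_member)
    moreover from this eq have "lam = replicate_mset (sum_mset lam) 1" by simp
    ultimately show "a = 1 \<and> size lam = sum_mset lam" by (metis size_replicate_mset)
  qed
  finally show ?case .
qed simp

lemma to_fract_power: "to_fract (p ^ n) = to_fract p ^ n"
  by (induction n) simp_all

text \<open>\<open>x = c q^(n choose 2) + O(q^(n-1 choose 2))\<close>, with \<open>x\<close> a multiple of \<open>(1-q)^s\<close>: since every
  product of homogeneous elements of positive degrees is \<open>O(q^(n-1 choose 2))\<close>, only the
  indecomposable part is seen by \<open>c\<close>.\<close>

definition admissible :: "nat \<Rightarrow> nat \<Rightarrow> rat \<Rightarrow> rat poly fract \<Rightarrow> bool" where
  "admissible n s c x \<longleftrightarrow> (\<exists>p. x = to_fract p \<and> [:1, -1:] ^ s dvd p \<and>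
     degree (p - monom c (n choose 2)) \<le> (n - 1) choose 2)"

lemma admissible_0: "admissible n s 0 0"
  unfolding admissible_def by (intro exI[of _ 0]) simp

lemma admissible_add:
  assumes "admissible n s c x" "admissible n s d y"
  shows "admissible n s (c + d) (x + y)"
proof -
  obtain p u where
    p: "x = to_fract p" "[:1, -1:] ^ s dvd p" "degree (p - monom c (n choose 2)) \<le> (n - 1) choose 2" and
    u: "y = to_fract u" "[:1, -1:] ^ s dvd u" "degree (u - monom d (n choose 2)) \<le> (n - 1) choose 2"
    using assms unfolding admissible_def by blast
  have "p + u - monom (c + d) (n choose 2) = (p - monom c (n choose 2)) + (u - monom d (n choose 2))"
    by (simp add: add_monom[symmetric])
  then have "degree (p + u - monom (c + d) (n choose 2)) \<le> (n - 1) choose 2"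
    using p(3) u(3) by (simp only: degree_add_le)
  then show ?thesis using p u unfolding admissible_def by (intro exI[of _ "p + u"]) simp
qed

lemma admissible_uminus: "admissible n s c x \<Longrightarrow> admissible n s (- c) (- x)"
  unfolding admissible_def
proof (elim exE conjE)
  fix p assume p: "x = to_fract p" "[:1, -1:] ^ s dvd p"
    "degree (p - monom c (n choose 2)) \<le> (n - 1) choose 2"
  have "- p - monom (- c) (n choose 2) = - (p - monom c (n choose 2))"
    by (simp add: minus_monom[symmetric])
  then have "degree (- p - monom (- c) (n choose 2)) \<le> (n - 1) choose 2"
    using p(3) by (simp only: degree_minus)
  then show "\<exists>p. - x = to_fract p \<and> [:1, -1:] ^ s dvd p \<and>
      degree (p - monom (- c) (n choose 2)) \<le> (n - 1) choose 2"
    using p by (intro exI[of _ "- p"]) simp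
qed

lemma admissible_diff:
  "admissible n s c x \<Longrightarrow> admissible n s d y \<Longrightarrow> admissible n s (c - d) (x - y)"
  using admissible_add[OF _ admissible_uminus] by fastforce

lemma admissible_sign: "admissible n s c x \<Longrightarrow> admissible n s ((-1) ^ i * c) ((-1) ^ i * x)"
  by (cases "even i") (simp_all add: admissible_uminus)

lemma admissible_sum_mset:
  "(\<And>a. a \<in># A \<Longrightarrow> admissible n s c (f a)) \<Longrightarrow>
    admissible n s (of_nat (size A) * c) (\<Sum>a\<in>#A. f a)"
  by (induction A) (simp_all add: admissible_0 admissible_add distrib_right)

lemma admissible_sum:
  "(\<And>a. a \<in> A \<Longrightarrow> admissible n s 0 (f a)) \<Longrightarrow> admissible n s 0 (\<Sum>a\<in>A. f a)"
  by (induction A rule: infinite_finite_induct)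
    (use admissible_0 admissible_add[of n s 0 _ 0] in auto)

lemma admissible_weaken:
  assumes "admissible n s c x" "t \<le> s"
  shows "admissible n t c x"
proof -
  have "[:1, -1:] ^ t dvd p" if "[:1, -1:] ^ s dvd p" for p :: "rat poly"
    using le_imp_power_dvd[OF assms(2)] that by (rule dvd_trans)
  then show ?thesis using assms(1) unfolding admissible_def by blast
qed

text \<open>The factors have degrees at most (k choose 2) and (l choose 2), so by
  \<open>choose_two_add_le\<close> the product lies entirely in the error range.\<close>

lemma admissible_mult:
  assumes "k > 0" "l > 0" "admissible k s c x" "admissible l t d y"
  shows "admissible (k + l) (s + t) 0 (x * y)"
proof -
  have *: "degree p \<le> n choose 2" if "degree (p - monom a (n choose 2)) \<le> (n - 1) choose 2"
    for p :: "rat poly" and a n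
  proof -
    have "degree (p - monom a (n choose 2)) \<le> n choose 2"
      using that binomial_right_mono[of "n - 1" n 2] by linarith
    then have "degree ((p - monom a (n choose 2)) + monom a (n choose 2)) \<le> n choose 2"
      by (rule degree_add_le) (rule degree_monom_le)
    then show ?thesis by simp
  qed
  obtain p where p: "x = to_fract p" "[:1, -1:] ^ s dvd p" "degree p \<le> k choose 2"
    using assms(3) * unfolding admissible_def by blast
  obtain u where u: "y = to_fract u" "[:1, -1:] ^ t dvd u" "degree u \<le> l choose 2"
    using assms(4) * unfolding admissible_def by blast
  have "degree (p * u) \<le> (k + l - 1) choose 2"
    using degree_mult_le[of p u] p(3) u(3) choose_two_add_le[OF assms(1,2)] by linarith
  moreover have "[:1, -1:] ^ (s + t) dvd p * u"
    unfolding power_add using p(2) u(2) by (rule mult_dvd_mono)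
  ultimately show ?thesis
    using p(1) u(1) unfolding admissible_def by (intro exI[of _ "p * u"]) simp
qed

text \<open>Leading term and divisibility may be proved separately: \<open>to_fract\<close> is
  injective, so both statements concern the same polynomial.\<close>

lemma admissible_combine:
  assumes "admissible n t c x" "x = to_fract ([:1, -1:] ^ s * p)"
  shows "admissible n s c x"
  using assms unfolding admissible_def by (auto simp del: to_fract_mult)

text \<open>With \<open>E' = E(qt)\<close>, the logarithmic derivative \<open>P = E'/E\<close> satisfies
  \<open>P' = P * (q P(qt) - P)\<close>: differentiate \<open>P * E = E(qt)\<close> and cancel \<open>E\<close>.\<close>

lemma logarithmic_derivative_recurrence:
  fixes E P :: "'a::idom fps"
  assumes E: "fps_deriv E = E oo (fps_const c * fps_X)" and P: "P * E = fps_deriv E" and "E \<noteq> 0"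
  shows "of_nat (Suc n) * P $ Suc n = (\<Sum>i=0..n. P $ i * ((c ^ Suc (n - i) - 1) * P $ (n - i)))"
proof -
  let ?X = "fps_const c * fps_X"
  have X0: "?X $ 0 = 0" by simp
  have "P * fps_deriv E + fps_deriv P * E = fps_deriv (E oo ?X)"
    using P E by (metis fps_deriv_mult)
  also have "\<dots> = fps_const c * ((P * E) oo ?X)"
    unfolding fps_compose_deriv[OF X0] P by (simp add: mult.commute)
  also have "\<dots> = fps_const c * (P oo ?X) * (P * E)"
    unfolding fps_compose_mult_distrib[OF X0] by (simp only: P E mult.assoc)
  finally have "fps_deriv P * E = (P * (fps_const c * (P oo ?X) - P)) * E"
    unfolding P[symmetric] by (simp add: algebra_simps)
  then have "fps_deriv P = P * (fps_const c * (P oo ?X) - P)" using \<open>E \<noteq> 0\<close> by simp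
  then have "fps_deriv P $ n = (P * (fps_const c * (P oo ?X) - P)) $ n" by simp
  then show ?thesis
    unfolding fps_deriv_nth fps_mult_nth fps_compose_linear
    by (simp add: algebra_simps)
qed

lemma one_minus_X_dvd: "[:1, -1:] dvd [:0, 1 :: 'a::idom:] ^ m - 1"
proof -
  have "poly ([:0, 1 :: 'a:] ^ m - 1) 1 = 0" by (simp add: poly_power)
  then have "[:-1, 1 :: 'a:] dvd [:0, 1:] ^ m - 1" by (simp only: poly_eq_0_iff_dvd)
  then have "- [:-1, 1 :: 'a:] dvd [:0, 1:] ^ m - 1" by (simp only: minus_dvd_iff)
  then show ?thesis by simp
qed

text \<open>In each summand the two values of g contribute i and n - i factors 1 - q by induction,
  and q^(n-i+1) - 1, which has the root 1, contributes one more.\<close>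

lemma divisible_recurrence:
  fixes g :: "nat \<Rightarrow> rat poly fract"
  assumes "g 0 = 1"
    and rec: "\<And>n. of_nat (Suc n) * g (Suc n) = (\<Sum>i=0..n. g i * ((q ^ Suc (n - i) - 1) * g (n - i)))"
  shows "\<exists>p. g n = to_fract ([:1, -1:] ^ n * p)"
proof (induction n rule: less_induct)
  case (less n)
  show ?case
  proof (cases n)
    case 0
    then show ?thesis using assms(1) by (intro exI[of _ 1]) simp
  next
    case (Suc m)
    let ?P = "\<lambda>s x. \<exists>p. x = to_fract ([:1, -1:] ^ s * p)"
    have "?P n (g i * ((q ^ Suc (m - i) - 1) * g (m - i)))" if "i \<in> {0..m}" for i
    proof -
      have "i < n" "m - i < n" using that Suc by auto
      obtain a where a: "g i = to_fract ([:1, -1:] ^ i * a)" using less[OF \<open>i < n\<close>] by blast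
      obtain b where b: "g (m - i) = to_fract ([:1, -1:] ^ (m - i) * b)"
        using less[OF \<open>m - i < n\<close>] by blast
      obtain d where d: "[:0, 1 :: rat:] ^ Suc (m - i) - 1 = [:1, -1:] * d"
        using one_minus_X_dvd by (rule dvdE)
      have "q ^ Suc (m - i) - 1 = to_fract ([:0, 1:] ^ Suc (m - i) - 1)"
        by (simp only: to_fract_diff to_fract_1 to_fract_power to_fract_def[symmetric])
      then have "g i * ((q ^ Suc (m - i) - 1) * g (m - i)) =
          to_fract (([:1, -1:] ^ i * a) * (([:1, -1:] * d) * ([:1, -1:] ^ (m - i) * b)))"
        unfolding a b d by (simp only: to_fract_mult)
      also have "([:1, -1:] ^ i * a) * (([:1, -1:] * d) * ([:1, -1:] ^ (m - i) * b)) =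
          ([:1, -1:] * ([:1, -1:] ^ i * [:1, -1:] ^ (m - i))) * (a * d * b)"
        by (simp only: ac_simps)
      also have "[:1, -1:] * ([:1, -1:] ^ i * [:1, -1 :: rat:] ^ (m - i)) = [:1, -1:] ^ n"
        using that Suc by (simp flip: power_add)
      finally show ?thesis by blast
    qed
    then obtain h where h: "\<And>i. i \<in> {0..m} \<Longrightarrow>
        g i * ((q ^ Suc (m - i) - 1) * g (m - i)) = to_fract ([:1, -1:] ^ n * h i)"
      by metis
    have "of_nat n * g n = to_fract ([:1, -1:] ^ n * (\<Sum>i=0..m. h i))"
      unfolding Suc rec sum_distrib_left to_fract_sum using h Suc by (intro sum.cong) auto
    \<comment> \<open>Division by n only rescales the coefficients by a rational number.\<close>
    also have "(\<Sum>i=0..m. h i) = of_nat n * smult (1 / of_nat n) (\<Sum>i=0..m. h i)"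
      using Suc by (simp add: of_nat_poly)
    also have "to_fract ([:1, -1:] ^ n * (of_nat n * smult (1 / of_nat n) (\<Sum>i=0..m. h i))) =
        of_nat n * to_fract ([:1, -1:] ^ n * smult (1 / of_nat n) (\<Sum>i=0..m. h i))"
      by (simp add: of_nat_fract to_fract_def mult.left_commute)
    finally have "g n = to_fract ([:1, -1:] ^ n * smult (1 / of_nat n) (\<Sum>i=0..m. h i))"
      using Suc by (simp del: of_nat_Suc)
    then show ?thesis ..
  qed
qed

section \<open>The specialization of augmented monomials\<close>

definition elem :: "nat \<Rightarrow> rat poly fract" where
  "elem n = q ^ (n choose 2) / of_nat (fact n)"

text \<open>The equation E'(t) = E(qt), read off at the coefficient of t^n.\<close>

lemma elem_Suc: "of_nat (Suc n) * elem (Suc n) = q ^ n * elem n"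
  unfolding elem_def fact_Suc of_nat_mult choose_two_Suc power_add
  by (simp del: of_nat_Suc of_nat_fact fact_Suc)

lemma elem_to_fract: "elem n = to_fract (monom (1 / fact n) (n choose 2))"
proof -
  have "of_nat (fact n) * monom (1 / fact n :: rat) (n choose 2) = [:0, 1:] ^ (n choose 2)"
    by (simp add: monom_altdef of_nat_poly del: of_nat_fact) simp
  then have "to_fract (of_nat (fact n)) * to_fract (monom (1 / fact n :: rat) (n choose 2)) =
      to_fract [:0, 1:] ^ (n choose 2)"
    by (simp only: to_fract_mult[symmetric] to_fract_power[symmetric])
  then show ?thesis unfolding elem_def
    by (simp add: Fract_of_nat_eq to_fract_def field_simps del: of_nat_fact)
qed

lemma admissible_monom: "admissible n 0 c (to_fract (monom c (n choose 2)))"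
  unfolding admissible_def by (intro exI[of _ "monom c (n choose 2)"]) simp

lemma admissible_elem: "admissible n 0 (1 / fact n) (elem n)"
  unfolding elem_to_fract by (rule admissible_monom)

context
  fixes \<phi> :: "rat poly fract symfun \<Rightarrow> rat poly fract"
  assumes spec: "is_specialization \<phi>"
begin

lemma hom_add: "\<phi> (f + g) = \<phi> f + \<phi> g"
  and hom_mult: "\<phi> (f * g) = \<phi> f * \<phi> g"
  and hom_1: "\<phi> 1 = 1"
  and spec_elementary: "\<phi> (elementary_sym n) = q ^ (n choose 2) / of_nat (fact n)"
  using spec unfolding is_specialization_def algebra_hom_def by simp_all

lemma hom_0: "\<phi> 0 = 0"
  using hom_add[of 0 0] by simp

lemma hom_of_nat: "\<phi> (of_nat k) = of_nat k"
  by (induction k) (simp_all add: hom_0 hom_1 hom_add)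

lemma hom_sum_mset: "\<phi> (\<Sum>a\<in>#A. f a) = (\<Sum>a\<in>#A. \<phi> (f a))"
  by (induction A) (simp_all add: hom_0 hom_add)

lemma spec_powersum_mult:
  assumes "k > 0" "0 \<notin># mu"
  shows "\<phi> (augmented_sym {#k#}) * \<phi> (augmented_sym mu) = \<phi> (augmented_sym (add_mset k mu)) +
    (\<Sum>a\<in>#mu. \<phi> (augmented_sym (add_mset (a + k) (mu - {#a#}))))"
proof -
  have "augmented_sym {#k#} = (monomial_sym {#k#} :: rat poly fract symfun)"
    by (simp add: augmented_sym_def multiplicity_fact_single)
  then show ?thesis
    using arg_cong[OF powersum_mult_augmented[OF assms], of \<phi>]
    by (simp only: hom_mult hom_add hom_sum_mset)
qed

lemma spec_ones: "\<phi> (augmented_sym (replicate_mset n 1)) = q ^ (n choose 2)"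
  unfolding augmented_sym_def multiplicity_fact_replicate monomial_sym_ones
    hom_mult hom_of_nat spec_elementary by simp

section \<open>Newton's identities and the images of the power sums\<close>

definition powersum :: "nat \<Rightarrow> rat poly fract" where
  "powersum k = \<phi> (augmented_sym {#k#})"

text \<open>Each product of a power sum and an elementary function is a sum of two neighbouring hook
  terms, so the alternating sum telescopes.\<close>

lemma newton: "(\<Sum>i=0..n. (-1) ^ i * powersum (Suc i) * elem (n - i)) = of_nat (Suc n) * elem (Suc n)"
proof -
  \<comment> \<open>For i > 0 this is the image of the monomial function of (i+1, 1^(n-i)). At i = 0
    the divisor is n! instead of (n+1)!, which produces the right side (n+1) e_(n+1).\<close>
  define hook where
    "hook i = \<phi> (augmented_sym (add_mset (Suc i) (replicate_mset (n - i) 1))) / of_nat (fact (n - i))"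
    for i
  have step: "powersum (Suc i) * elem (n - i) = hook i + hook (Suc i)" if "i < n" for i
  proof -
    have n: "n - i = Suc (n - Suc i)" using that by simp
    have "(\<Sum>a\<in>#replicate_mset (n - i) 1. \<phi> (augmented_sym (add_mset (a + Suc i)
        (replicate_mset (n - i) 1 - {#a#})))) =
      of_nat (n - i) * \<phi> (augmented_sym (add_mset (Suc (Suc i)) (replicate_mset (n - Suc i) 1)))"
      unfolding n by (simp add: distrib_right)
    with spec_powersum_mult[of "Suc i" "replicate_mset (n - i) 1"]
    have "powersum (Suc i) * q ^ ((n - i) choose 2) =
      \<phi> (augmented_sym (add_mset (Suc i) (replicate_mset (n - i) 1))) +
      of_nat (n - i) * \<phi> (augmented_sym (add_mset (Suc (Suc i)) (replicate_mset (n - Suc i) 1)))"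
      unfolding spec_ones powersum_def by simp
    moreover have "of_nat (fact (n - i)) =
        (of_nat (n - i) * of_nat (fact (n - Suc i)) :: rat poly fract)"
      unfolding n fact_Suc by (simp only: of_nat_mult of_nat_id)
    ultimately show ?thesis
      unfolding elem_def hook_def using that
      by (simp add: add_divide_distrib del: of_nat_fact)
  qed
  have "(\<Sum>i<m. (-1) ^ i * powersum (Suc i) * elem (n - i)) = hook 0 - (-1) ^ m * hook m" if "m \<le> n" for m
    using that
  proof (induction m)
    case (Suc m)
    then have "(-1) ^ m * powersum (Suc m) * elem (n - m) = (-1) ^ m * (hook m + hook (Suc m))"
      by (simp add: mult.assoc step)
    then show ?case using Suc by (simp add: algebra_simps)
  qed simp
  then have "(\<Sum>i<n. (-1) ^ i * powersum (Suc i) * elem (n - i)) = hook 0 - (-1) ^ n * hook n" by simp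
  \<comment> \<open>The last summand cancels the remaining boundary term, as e_0 = 1.\<close>
  moreover have "powersum (Suc n) * elem 0 = hook n"
    by (simp add: powersum_def elem_def hook_def numeral_2_eq_2)
  moreover have "hook 0 = of_nat (Suc n) * elem (Suc n)"
    using spec_ones[of "Suc n"] unfolding hook_def elem_def fact_Suc of_nat_mult
    by (simp del: of_nat_Suc of_nat_fact fact_Suc)
  moreover have "{0..n} = insert n {..<n}" by auto
  ultimately show ?thesis by simp
qed

text \<open>By Newton's identities P is the logarithmic derivative of E, so its coefficients satisfy
  the recurrence of \<open>divisible_recurrence\<close>, with initial value p_1 = e_1 = 1.\<close>

lemma powersum_divisible: "\<exists>p. powersum (Suc n) = to_fract ([:1, -1:] ^ n * p)"
proof -
  define E where "E = Abs_fps elem"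
  define P where "P = Abs_fps (\<lambda>i. (-1) ^ i * powersum (Suc i))"
  have E: "fps_deriv E = E oo (fps_const q * fps_X)"
    unfolding E_def fps_compose_linear by (rule fps_ext) (simp add: elem_Suc del: of_nat_Suc)
  have P: "P * E = fps_deriv E"
    by (rule fps_ext) (simp add: E_def P_def fps_mult_nth newton del: of_nat_Suc)
  have "E $ 0 = 1" by (simp add: E_def elem_def numeral_2_eq_2)
  then have "E \<noteq> 0" by auto
  have "P $ 0 = 1"
    using newton[of 0] elem_Suc[of 0] by (simp add: P_def elem_def numeral_2_eq_2)
  then obtain p where "P $ n = to_fract ([:1, -1:] ^ n * p)"
    using divisible_recurrence[of "fps_nth P" n]
      logarithmic_derivative_recurrence[OF E P \<open>E \<noteq> 0\<close>] by blast
  then have "powersum (Suc n) = (-1) ^ n * to_fract ([:1, -1:] ^ n * p)"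
    unfolding P_def by (cases "even n") (simp_all del: to_fract_mult)
  also have "\<dots> = to_fract ([:1, -1:] ^ n * ((-1) ^ n * p))"
    by (simp add: to_fract_power)
  finally show ?thesis ..
qed

text \<open>In Newton's identities all summands with i < n are products of positive degrees. Hence
  (-1)^n p_(n+1) has the leading coefficient of (n+1) e_(n+1) = q^n e_n, which is 1/n!.\<close>

lemma admissible_powersum:
  "admissible (Suc n) n ((-1) ^ n / fact n) (powersum (Suc n))"
proof -
  \<comment> \<open>Only the leading term is treated here, with exponent 0 of 1 - q, because the e_n
    carry no such factor.\<close>
  have "admissible (Suc n) 0 ((-1) ^ n / fact n) (powersum (Suc n))"
  proof (induction n rule: less_induct)
    case (less n)
    have summand: "admissible (Suc n) 0 0 ((-1) ^ i * powersum (Suc i) * elem (n - i))" if "i \<in> {..<n}" for i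
      using that admissible_sign[OF admissible_mult[OF _ _ less admissible_elem[of "n - i"]], of i i]
      by (simp add: mult.assoc)
    have "{0..n} = insert n {..<n}" by auto
    then have "(-1) ^ n * powersum (Suc n) = q ^ n * elem n -
        (\<Sum>i<n. (-1) ^ i * powersum (Suc i) * elem (n - i))"
      using newton[of n] unfolding elem_Suc
      by (simp add: elem_def numeral_2_eq_2)
    moreover have "q ^ n * elem n = to_fract (monom (1 / fact n) (Suc n choose 2))"
      unfolding elem_to_fract
      by (simp add: to_fract_power[symmetric] to_fract_def[symmetric] to_fract_mult[symmetric]
          monom_altdef choose_two_Suc power_add mult.commute del: to_fract_mult)
    ultimately have "admissible (Suc n) 0 (1 / fact n - 0) ((-1) ^ n * powersum (Suc n))"
      using admissible_diff[OF admissible_monom admissible_sum[of "{..<n}", OF summand]] by simp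
    then show ?case
      using admissible_sign[of "Suc n" 0 "1 / fact n" "(-1) ^ n * powersum (Suc n)" n]
      by (simp add: mult.assoc[symmetric] power_mult_distrib[symmetric])
  qed
  then show ?thesis using powersum_divisible[of n] by (blast intro: admissible_combine)
qed

text \<open>Modulo products, adding a part to \<open>mu\<close> amounts to minus the sum over all ways of adding it
  to an existing part; products only contribute to degrees at most \<open>(n - 1) choose 2\<close>.\<close>

lemma admissible_augmented:
  assumes "0 \<notin># lam" "size lam = Suc r" "sum_mset lam = n"
  shows "admissible n (n - Suc r) ((-1) ^ (n - Suc r) * fact r / fact (n - 1)) (\<phi> (augmented_sym lam))"
  using assms
proof (induction r arbitrary: lam n)
  case 0
  then obtain k where k: "lam = {#k#}" by (metis One_nat_def size_1_singleton_mset)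
  then obtain m where "n = Suc m" using 0 by (cases n) auto
  then show ?case using admissible_powersum[of m] 0 k by (simp add: powersum_def)
next
  case (Suc r)
  then obtain k mu where lam: "lam = add_mset k mu" by (metis size_eq_Suc_imp_eq_union)
  then have mu: "0 \<notin># mu" "size mu = Suc r" "k > 0" "k + sum_mset mu = n"
    using Suc.prems by auto
  define l where "l = sum_mset mu"
  have l: "l \<ge> Suc r" "n = k + l" using size_le_sum_mset[OF mu(1)] mu by (simp_all add: l_def)
  let ?c = "(-1) ^ (n - Suc r) * fact r / fact (n - 1) :: rat"
  obtain j where j: "k = Suc j" using mu by (cases k) auto
  have "admissible l (l - Suc r) ((-1) ^ (l - Suc r) * fact r / fact (l - 1)) (\<phi> (augmented_sym mu))"
    using Suc.IH mu l_def by blast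
  then have "admissible (k + l) (j + (l - Suc r)) 0 (powersum k * \<phi> (augmented_sym mu))"
    using l admissible_powersum[of j] unfolding j by (intro admissible_mult) auto
  \<comment> \<open>Since k = j + 1, the exponent j + (l - r - 1) is exactly n - r - 2. The merged
    terms below have one factor 1 - q more and are weakened to this exponent.\<close>
  then have prod: "admissible n (n - Suc (Suc r)) 0 (powersum k * \<phi> (augmented_sym mu))"
    using l j by simp
  have "admissible n (n - Suc (Suc r)) ?c (\<phi> (augmented_sym (add_mset (a + k) (mu - {#a#}))))"
    if "a \<in># mu" for a
  proof -
    obtain rho where rho: "mu = add_mset a rho" using \<open>a \<in># mu\<close> by (metis insert_DiffM)
    have "admissible n (n - Suc r) ?c (\<phi> (augmented_sym (add_mset (a + k) rho)))"
      using mu unfolding rho by (intro Suc.IH) auto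
    then show ?thesis using rho by (auto intro: admissible_weaken)
  qed
  then have "admissible n (n - Suc (Suc r)) (of_nat (size mu) * ?c)
      (\<Sum>a\<in>#mu. \<phi> (augmented_sym (add_mset (a + k) (mu - {#a#}))))"
    by (rule admissible_sum_mset)
  \<comment> \<open>The r + 1 merged terms share the constant \<open>?c\<close>; subtracting them
    turns r! into (r+1)! and flips the sign.\<close>
  from admissible_diff[OF prod this]
  have "admissible n (n - Suc (Suc r)) (0 - of_nat (size mu) * ?c) (\<phi> (augmented_sym lam))"
    using spec_powersum_mult[OF mu(3,1)] unfolding lam powersum_def by simp
  moreover have "n - Suc r = Suc (n - Suc (Suc r))" using l j by simp
  ultimately show ?case using mu(2) by (simp add: algebra_simps)
qed

end

section \<open>Reading off the upper part of \<open>M_poly\<close>\<close>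

lemma one_minus_q: "1 - to_fract [:0, 1:] = to_fract [:1, -1 :: rat:]"
  by (simp add: to_fract_def One_fract_def one_pCons)

theorem theorem5p1:
  fixes \<phi> :: "rat poly fract symfun \<Rightarrow> rat poly fract"
    and lam :: "nat multiset" and n r :: nat
  assumes "is_specialization \<phi>"
    and "is_partition_of lam n" and "size lam = r"
  shows "(lam \<noteq> replicate_mset n 1 \<longleftrightarrow> 1 \<le> r \<and> r \<le> n - 1) \<and>
    (lam \<noteq> replicate_mset n 1 \<longrightarrow>
      deg_v n r = ((n - 2) choose 2) + r - 1 \<and>
      upper_part (deg_v n r) (M_poly \<phi> lam) = P_poly n r \<and>
      P_poly n r = smult (fact (r - 1) / fact (n - 1))
        (\<Sum>j=0..n-2. monom (of_nat ((2 * n - r - 3 - j) choose (n - 2 - j))) (deg_v n r + j)))"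
proof -
  have lam: "0 \<notin># lam" "sum_mset lam = n" using assms(2) by (simp_all add: is_partition_of_def)
  have "r \<le> n" "r = n \<longleftrightarrow> lam = replicate_mset n 1"
    using size_le_sum_mset[OF lam(1)] size_eq_sum_mset_iff[OF lam(1)] lam(2) assms(3) by auto
  \<comment> \<open>The empty partition is 1^0, so it falls under the excluded case.\<close>
  moreover have "r = 0 \<longrightarrow> n = 0" using assms(3) lam(2) by auto
  ultimately have equiv: "lam \<noteq> replicate_mset n 1 \<longleftrightarrow> 1 \<le> r \<and> r \<le> n - 1" by auto
  have "deg_v n r = ((n - 2) choose 2) + r - 1 \<and>
      upper_part (deg_v n r) (M_poly \<phi> lam) = P_poly n r \<and>
      P_poly n r = smult (fact (r - 1) / fact (n - 1))
        (\<Sum>j=0..n-2. monom (of_nat ((2 * n - r - 3 - j) choose (n - 2 - j))) (deg_v n r + j))"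
    if "lam \<noteq> replicate_mset n 1"
  proof -
    from that equiv have r: "1 \<le> r" "r < n" by auto
    then have v: "deg_v n r = ((n - 2) choose 2) + r - 1" by (intro deg_v_eq) auto
    let ?c = "(-1) ^ (n - r) * fact (r - 1) / fact (n - 1) :: rat"
    have "admissible n (n - Suc (r - 1)) ((-1) ^ (n - Suc (r - 1)) * fact (r - 1) / fact (n - 1))
        (\<phi> (augmented_sym lam))"
      using r assms(3) lam by (intro admissible_augmented[OF assms(1)]) auto
    then have "admissible n (n - r) ?c (\<phi> (augmented_sym lam))" using r by simp
    then obtain M where M: "\<phi> (augmented_sym lam) = to_fract ([:1, -1:] ^ (n - r) * M)"
      "degree ([:1, -1:] ^ (n - r) * M - monom ?c (n choose 2)) \<le> (n - 1) choose 2"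
      unfolding admissible_def by (metis dvdE)
    have "M_poly \<phi> lam = M"
      using M(1) unfolding augmented_sym_def hom_mult[OF assms(1)] hom_of_nat[OF assms(1)]
      by (intro M_poly_eqI) (simp add: lam(2) assms(3) one_minus_q to_fract_power to_fract_def[symmetric])
    moreover have "upper_part (deg_v n r) M = P_poly n r"
    proof (rule upper_part_eqI)
      fix i assume "deg_v n r \<le> i"
      have "n = Suc (Suc (n - 2))" using r by linarith
      then obtain k where n: "n = Suc (Suc k)" ..
      have "degree ([:1, -1 :: rat:] ^ (n - r)) = n - r" by (simp add: degree_power_eq)
      \<comment> \<open>Here v + (n - r) = (n-1 choose 2) + 1, so the error terms end just below
        degree v after division by (1-q)^(n-r).\<close>
      then have "(n - 1) choose 2 < deg_v n r + degree ([:1, -1 :: rat:] ^ (n - r))"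
        using v r by (simp add: n choose_two_Suc)
      then show "coeff M i = coeff (P_poly n r) i"
        using coeff_eq_above[OF _ M(2) degree_mult_P_poly[OF r]] \<open>deg_v n r \<le> i\<close> by simp
    next
      fix i assume "i < deg_v n r"
      \<comment> \<open>The reversed form has only exponents v + j.\<close>
      then show "coeff (P_poly n r) i = 0"
        unfolding P_poly_rev[OF r] by (simp add: coeff_sum)
    qed
    ultimately show ?thesis using v P_poly_rev[OF r] by simp
  qed
  with equiv show ?thesis by blast
qed

end
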